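(* Let $\mathbf{c}=c_0c_1c_2\cdots\in\{0,1\}^{\infty}$ with $c_0=1$. Then $\mathbf{c}$ is ($0$-$1$) apwenian if and only if for all $n\geq 0$, \[c_n\equiv c_{2n+1}+c_{2n+2}\pmod 2.\]
   Context: For an integer sequence $\mathbf{a}$, $H_n(\mathbf{a})=\det(a_{i+j})_{0\leq i,j\leq n-1}$. A sequence $\mathbf{c}\in\{0,1\}^{\infty}$ is called ($0$-$1$) apwenian if $H_n(\mathbf{c})\equiv 1\pmod 2$ for all $n\geq 1$. *)

theory Defs
  imports "Jordan_Normal_Form.Determinant" "HOL-Number_Theory.Cong"
begin

definition hankel_det :: "nat \<Rightarrow> (nat \<Rightarrow> int) \<Rightarrow> int" where
  "hankel_det n a = det (mat n n (\<lambda>(i, j). a (i + j)))"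

definition zero_one_seq :: "(nat \<Rightarrow> int) \<Rightarrow> bool" where
  "zero_one_seq c \<longleftrightarrow> (\<forall>n. c n \<in> {0, 1})"

definition apwenian :: "(nat \<Rightarrow> int) \<Rightarrow> bool" where
  "apwenian c \<longleftrightarrow> zero_one_seq c \<and> (\<forall>n\<ge>1. [hankel_det n c = 1] (mod 2))"

end

theory Submission
  imports Defs "HOL-Library.Z2"
begin

text \<open>
  Let \<open>L\<close> be the linear functional on polynomials with \<open>L(X\<^sup>n) = c\<^sub>n\<close>. If the monic polynomials
  \<open>p\<^sub>k\<close> of degree \<open>k\<close> are orthogonal for \<open>L\<close>, a unitriangular change of basis turns the Hankel
  matrix into a diagonal one, so all Hankel determinants are nonzero iff all norms \<open>L(p\<^sub>k\<^sup>2)\<close> are.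
  Over the field with two elements squaring is additive, hence so is the defect
  \<open>L((X + X\<^sup>2) p\<^sup>2) - L(p)\<close>: it vanishes on all the monomials, where it expresses the recurrence
  for \<open>c\<close>, iff it vanishes on all the \<open>p\<^sub>k\<close>. Squaring the three-term recurrence
  \<open>p\<^sub>k\<^sub>+\<^sub>1 = (X + a\<^sub>k) p\<^sub>k + p\<^sub>k\<^sub>-\<^sub>1\<close>, where \<open>a\<^sub>k = L(X p\<^sub>k\<^sup>2) = a\<^sub>k\<^sup>2\<close>, shows that the norm of \<open>p\<^sub>k\<^sub>+\<^sub>1\<close>
  is 1 plus the defect of \<open>p\<^sub>k\<close>, so by induction the norms are all 1 iff the defects are all 0.
\<close>

subsection \<open>Moment functionals\<close>

definition moment_functional :: "(nat \<Rightarrow> 'a::comm_ring_1) \<Rightarrow> 'a poly \<Rightarrow> 'a" where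
  "moment_functional c p = (\<Sum>i\<le>degree p. coeff p i * c i)"

lemma moment_functional_altdef:
  assumes "degree p \<le> n"
  shows "moment_functional c p = (\<Sum>i\<le>n. coeff p i * c i)"
  unfolding moment_functional_def using assms
  by (intro sum.mono_neutral_left) (auto simp: coeff_eq_0)

lemma moment_functional_0 [simp]: "moment_functional c 0 = 0"
  by (simp add: moment_functional_def)

lemma moment_functional_1 [simp]: "moment_functional c 1 = c 0"
  by (simp add: moment_functional_def)

lemma moment_functional_add:
  "moment_functional c (p + q) = moment_functional c p + moment_functional c q"
proof -
  let ?n = "max (degree p) (degree q)"
  have "moment_functional c (p + q) = (\<Sum>i\<le>?n. coeff (p + q) i * c i)"
    by (rule moment_functional_altdef) (rule degree_add_le_max)
  also have "\<dots> = (\<Sum>i\<le>?n. coeff p i * c i) + (\<Sum>i\<le>?n. coeff q i * c i)"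
    by (simp add: distrib_right sum.distrib)
  finally show ?thesis
    by (simp add: moment_functional_altdef[where n = ?n])
qed

lemma moment_functional_smult:
  "moment_functional c (smult a p) = a * moment_functional c p"
  using moment_functional_altdef[OF degree_smult_le, of c a p]
  by (simp add: moment_functional_def sum_distrib_left mult.assoc)

lemma moment_functional_diff:
  "moment_functional c (p - q) = moment_functional c p - moment_functional c q"
  using moment_functional_add[of c "p - q" q] by simp

lemma moment_functional_monom [simp]: "moment_functional c (monom a n) = a * c n"
proof -
  have "moment_functional c (monom a n) = (\<Sum>i\<le>n. coeff (monom a n) i * c i)"
    by (rule moment_functional_altdef) (rule degree_monom_le)
  also have "\<dots> = (\<Sum>i\<le>n. if i = n then a * c n else 0)"
    by (intro sum.cong) auto
  finally show ?thesis by simp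
qed

lemma moment_functional_sum:
  "moment_functional c (\<Sum>i\<in>A. f i) = (\<Sum>i\<in>A. moment_functional c (f i))"
  by (induction A rule: infinite_finite_induct) (simp_all add: moment_functional_add)

lemma moment_functional_mult:
  assumes "degree p \<le> m" "degree q \<le> n"
  shows "moment_functional c (p * q) = (\<Sum>i\<le>m. \<Sum>j\<le>n. coeff p i * c (i + j) * coeff q j)"
proof -
  have "p * q = (\<Sum>i\<le>m. monom (coeff p i) i) * (\<Sum>j\<le>n. monom (coeff q j) j)"
    by (simp only: poly_as_sum_of_monoms' assms)
  also have "\<dots> = (\<Sum>i\<le>m. \<Sum>j\<le>n. monom (coeff p i * coeff q j) (i + j))"
    by (simp add: sum_product mult_monom)
  finally show ?thesis
    by (simp add: moment_functional_sum mult_ac)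
qed

subsection \<open>Monic sequences\<close>

definition monic_sequence :: "(nat \<Rightarrow> 'a::comm_ring_1 poly) \<Rightarrow> bool" where
  "monic_sequence p \<longleftrightarrow> (\<forall>k. degree (p k) = k \<and> coeff (p k) k = 1)"

lemma degree_monic_sequence: "monic_sequence p \<Longrightarrow> degree (p k) = k"
  and coeff_monic_sequence: "monic_sequence p \<Longrightarrow> coeff (p k) k = 1"
  by (simp_all add: monic_sequence_def)

lemma monic_sequence_monom: "monic_sequence (monom 1)"
  by (simp add: monic_sequence_def degree_monom_eq)

lemma minus_smult_monic_eq_0_or_degree_less:
  fixes p b :: "'a::comm_ring_1 poly"
  assumes "degree p \<le> n" "degree b = n" "coeff b n = 1"
  shows "p - smult (coeff p n) b = 0 \<or> degree (p - smult (coeff p n) b) < n"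
proof (rule eq_zero_or_degree_less)
  show "degree (p - smult (coeff p n) b) \<le> n"
    using assms degree_smult_le[of "coeff p n" b] by (intro degree_diff_le) auto
qed (use assms in simp)

lemma monic_sequence_induct [consumes 1, case_names add smult]:
  assumes "monic_sequence b"
    and add: "\<And>p q. P p \<Longrightarrow> P q \<Longrightarrow> P (p + q)"
    and smult: "\<And>a k. P (smult a (b k))"
  shows "P p"
proof (induction "degree p" arbitrary: p rule: less_induct)
  case less
  let ?t = "smult (lead_coeff p) (b (degree p))"
  have "p - ?t = 0 \<or> degree (p - ?t) < degree p"
    by (rule minus_smult_monic_eq_0_or_degree_less)
      (simp_all only: degree_monic_sequence[OF assms(1)] coeff_monic_sequence[OF assms(1)] order_refl)
  then have "P (p - ?t)"
    using less smult[of 0 0] by auto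
  from add[OF this smult[of "lead_coeff p" "degree p"]] show ?case by simp
qed

subsection \<open>Hankel determinants\<close>

definition hankel_mat :: "nat \<Rightarrow> (nat \<Rightarrow> 'a) \<Rightarrow> 'a mat" where
  "hankel_mat n c = mat n n (\<lambda>(i, j). c (i + j))"

definition gram_mat :: "nat \<Rightarrow> (nat \<Rightarrow> 'a::comm_ring_1) \<Rightarrow> (nat \<Rightarrow> 'a poly) \<Rightarrow> 'a mat" where
  "gram_mat n c p = mat n n (\<lambda>(i, j). moment_functional c (p i * p j))"

lemma of_int_hankel_det:
  "(of_int (hankel_det n c) :: 'a::comm_ring_1) = det (hankel_mat n (\<lambda>i. of_int (c i)))"
  unfolding hankel_det_def hankel_mat_def of_int_hom.hom_det[symmetric]
  by (rule arg_cong[where f = det]) auto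

lemma gram_mat_eq_hankel_mat_congruence:
  assumes "\<And>k. k < n \<Longrightarrow> degree (p k) < n"
  defines "P \<equiv> mat n n (\<lambda>(i, j). coeff (p i) j)"
  shows "gram_mat n c p = P * hankel_mat n c * transpose_mat P"
proof (rule eq_matI)
  fix i j assume "i < dim_row (P * hankel_mat n c * transpose_mat P)"
    "j < dim_col (P * hankel_mat n c * transpose_mat P)"
  then have ij: "i < n" "j < n" by (simp_all add: P_def)
  then have degree_le: "degree (p i) \<le> n - 1" "degree (p j) \<le> n - 1"
    and interval: "{..n - 1} = {0..<n}"
    using assms(1)[of i] assms(1)[of j] by auto
  have "(P * hankel_mat n c * transpose_mat P) $$ (i, j)
      = (\<Sum>l = 0..<n. (\<Sum>k = 0..<n. coeff (p i) k * c (k + l)) * coeff (p j) l)"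
    using ij by (simp add: P_def hankel_mat_def scalar_prod_def)
  also have "\<dots> = (\<Sum>k = 0..<n. \<Sum>l = 0..<n. coeff (p i) k * c (k + l) * coeff (p j) l)"
    unfolding sum_distrib_right by (rule sum.swap)
  also have "\<dots> = moment_functional c (p i * p j)"
    by (rule moment_functional_mult [OF degree_le, unfolded interval, symmetric])
  finally show "gram_mat n c p $$ (i, j) = (P * hankel_mat n c * transpose_mat P) $$ (i, j)"
    using ij by (simp add: gram_mat_def)
qed (simp_all add: P_def gram_mat_def)

lemma det_gram_mat_monic:
  assumes "monic_sequence p"
  shows "det (gram_mat n c p) = det (hankel_mat n c)"
proof -
  define P where "P = mat n n (\<lambda>(i, j). coeff (p i) j)"
  have P_carrier: "P \<in> carrier_mat n n" and H_carrier: "hankel_mat n c \<in> carrier_mat n n"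
    by (simp_all add: P_def hankel_mat_def)
  have "det P = prod_list (diag_mat P)"
    by (rule det_lower_triangular[OF _ P_carrier])
      (simp add: P_def coeff_eq_0 degree_monic_sequence[OF assms])
  also have "\<dots> = 1"
    unfolding prod_list_diag_prod by (simp add: P_def coeff_monic_sequence[OF assms])
  finally have det_P: "det P = 1" .
  have "gram_mat n c p = P * hankel_mat n c * transpose_mat P"
    unfolding P_def
    by (rule gram_mat_eq_hankel_mat_congruence) (simp add: degree_monic_sequence[OF assms])
  also have "det \<dots> = det P * det (hankel_mat n c) * det (transpose_mat P)"
    using P_carrier H_carrier by (simp add: det_mult[of _ n])
  also have "\<dots> = det (hankel_mat n c)"
    by (simp add: det_P det_transpose[OF P_carrier])
  finally show ?thesis .
qed

lemma det_hankel_mat_orthogonal: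
  assumes "monic_sequence p"
    and orth: "\<And>j k. j < k \<Longrightarrow> k < n \<Longrightarrow> moment_functional c (p k * p j) = 0"
  shows "det (hankel_mat n c) = (\<Prod>k<n. moment_functional c ((p k)\<^sup>2))"
proof -
  have "det (hankel_mat n c) = det (gram_mat n c p)"
    by (rule det_gram_mat_monic [OF assms(1), symmetric])
  also have "\<dots> = prod_list (diag_mat (gram_mat n c p))"
  proof (rule det_lower_triangular)
    fix i j assume "i < j" "j < n"
    then show "gram_mat n c p $$ (i, j) = 0"
      using orth[of i j] by (simp add: gram_mat_def mult.commute)
  qed (simp add: gram_mat_def)
  also have "\<dots> = (\<Prod>k<n. moment_functional c ((p k)\<^sup>2))"
    unfolding prod_list_diag_prod by (simp add: gram_mat_def power2_eq_square atLeast0LessThan)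
  finally show ?thesis .
qed

subsection \<open>Orthogonal polynomials\<close>

definition orthogonal_below :: "(nat \<Rightarrow> 'a::comm_ring_1) \<Rightarrow> nat \<Rightarrow> 'a poly \<Rightarrow> bool" where
  "orthogonal_below c n p \<longleftrightarrow> (\<forall>q. q = 0 \<or> degree q < n \<longrightarrow> moment_functional c (p * q) = 0)"

lemma orthogonal_belowD:
  "orthogonal_below c n p \<Longrightarrow> q = 0 \<or> degree q < n \<Longrightarrow> moment_functional c (p * q) = 0"
  unfolding orthogonal_below_def by blast

lemma moment_functional_mult_orthogonal_below:
  assumes "orthogonal_below c n p" "degree p = n" "coeff p n = 1" "degree q \<le> n"
  shows "moment_functional c (p * q) = coeff q n * moment_functional c (p\<^sup>2)"
proof -
  let ?r = "q - smult (coeff q n) p"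
  have "p * q = p * ?r + smult (coeff q n) (p\<^sup>2)"
    by (simp add: algebra_simps power2_eq_square)
  moreover have "moment_functional c (p * ?r) = 0"
    by (rule orthogonal_belowD[OF assms(1) minus_smult_monic_eq_0_or_degree_less[OF assms(4,2,3)]])
  ultimately show ?thesis
    by (simp only: moment_functional_add moment_functional_smult add_0_left)
qed

text \<open>The three-term recurrence divides by the norms of earlier polynomials. Once a norm vanishes
  the later terms are still monic, but they need not be orthogonal.\<close>

fun orth_poly :: "(nat \<Rightarrow> 'a::field) \<Rightarrow> nat \<Rightarrow> 'a poly" where
  "orth_poly c 0 = 1"
| "orth_poly c (Suc n) =
    (let L = moment_functional c; p = orth_poly c n
     in pCons 0 p - smult (L (pCons 0 (p\<^sup>2)) / L (p\<^sup>2)) p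
       - (case n of 0 \<Rightarrow> 0
          | Suc m \<Rightarrow> smult (L (p\<^sup>2) / L ((orth_poly c m)\<^sup>2)) (orth_poly c m)))"

definition orth_norm :: "(nat \<Rightarrow> 'a::field) \<Rightarrow> nat \<Rightarrow> 'a" where
  "orth_norm c n = moment_functional c ((orth_poly c n)\<^sup>2)"

lemma orth_poly_Suc:
  "orth_poly c (Suc n) = pCons 0 (orth_poly c n)
    - smult (moment_functional c (pCons 0 ((orth_poly c n)\<^sup>2)) / orth_norm c n) (orth_poly c n)
    - (case n of 0 \<Rightarrow> 0 | Suc m \<Rightarrow> smult (orth_norm c n / orth_norm c m) (orth_poly c m))"
  by (simp only: orth_poly.simps Let_def orth_norm_def)

declare orth_poly.simps(2) [simp del]

lemma monic_sequence_orth_poly: "monic_sequence (orth_poly c)"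
proof -
  have "degree (orth_poly c n) = n \<and> coeff (orth_poly c n) n = 1" for n
  proof (induction n rule: less_induct)
    case (less n)
    show ?case
    proof (cases n)
      case 0
      then show ?thesis by simp
    next
      case (Suc m)
      define r where "r = (case m of 0 \<Rightarrow> 0
        | Suc k \<Rightarrow> smult (orth_norm c m / orth_norm c k) (orth_poly c k))"
      have "degree r \<le> m"
        using less Suc by (auto simp: r_def split: nat.split)
      then have "degree (orth_poly c n) \<le> n" "coeff (orth_poly c n) n = 1"
        using less[of m] Suc
        by (auto simp: orth_poly_Suc coeff_eq_0 simp flip: r_def intro!: degree_diff_le)
      then show ?thesis
        using le_degree[of "orth_poly c n" n] by simp
    qed
  qed
  then show ?thesis by (simp add: monic_sequence_def)
qed

lemmas degree_orth_poly [simp] = degree_monic_sequence [OF monic_sequence_orth_poly]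
lemmas coeff_orth_poly [simp] = coeff_monic_sequence [OF monic_sequence_orth_poly]

lemma moment_functional_orth_poly_mult:
  assumes "orthogonal_below c n (orth_poly c n)" "degree q \<le> n"
  shows "moment_functional c (orth_poly c n * q) = coeff q n * orth_norm c n"
  unfolding orth_norm_def by (rule moment_functional_mult_orthogonal_below) (simp_all add: assms)

lemma moment_functional_orth_poly_Suc_mult:
  "moment_functional c (orth_poly c (Suc n) * q) =
    moment_functional c (orth_poly c n * pCons 0 q)
    - moment_functional c (pCons 0 ((orth_poly c n)\<^sup>2)) / orth_norm c n
      * moment_functional c (orth_poly c n * q)
    - (case n of 0 \<Rightarrow> 0
       | Suc m \<Rightarrow> orth_norm c n / orth_norm c m * moment_functional c (orth_poly c m * q))"
  by (simp add: orth_poly_Suc left_diff_distrib moment_functional_diff moment_functional_smult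
      split: nat.split)

lemma moment_functional_orth_poly_Suc_orth_poly:
  assumes "orthogonal_below c n (orth_poly c n)" "orth_norm c n \<noteq> 0"
  shows "moment_functional c (orth_poly c (Suc n) * orth_poly c n) = 0"
proof -
  have "moment_functional c (orth_poly c m * orth_poly c n) = 0" if "n = Suc m" for m
    using orthogonal_belowD[OF assms(1), of "orth_poly c m"] that by (simp add: mult.commute)
  then show ?thesis
    using assms(2) unfolding moment_functional_orth_poly_Suc_mult
    by (simp add: orth_norm_def power2_eq_square split: nat.split)
qed

lemma orthogonal_below_orth_poly_Suc:
  assumes orth: "\<And>k. k \<le> n \<Longrightarrow> orthogonal_below c k (orth_poly c k)"
    and norm: "\<And>k. k \<le> n \<Longrightarrow> orth_norm c k \<noteq> 0"
  shows "orthogonal_below c n (orth_poly c (Suc n))"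
  unfolding orthogonal_below_def
proof (intro allI impI)
  fix q :: "'a poly" assume q: "q = 0 \<or> degree q < n"
  show "moment_functional c (orth_poly c (Suc n) * q) = 0"
  proof (cases n)
    case 0
    then show ?thesis using q by simp
  next
    case (Suc m)
    then have "degree q \<le> m" using q by auto
    then have "moment_functional c (orth_poly c n * pCons 0 q) = coeff q m * orth_norm c n"
      and "moment_functional c (orth_poly c m * q) = coeff q m * orth_norm c m"
      using moment_functional_orth_poly_mult[OF orth, of n "pCons 0 q"]
        moment_functional_orth_poly_mult[OF orth, of m q] Suc by simp_all
    then show ?thesis
      using orthogonal_belowD[OF orth[OF order_refl] q] norm[of m] Suc
      by (simp add: moment_functional_orth_poly_Suc_mult)
  qed
qed

lemma orthogonal_below_orth_poly:
  assumes "\<And>k. k < n \<Longrightarrow> orth_norm c k \<noteq> 0"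
  shows "orthogonal_below c n (orth_poly c n)"
  using assms
proof (induction n rule: less_induct)
  case (less n)
  show ?case
  proof (cases n)
    case 0
    then show ?thesis by (simp add: orthogonal_below_def)
  next
    case (Suc m)
    have orth: "orthogonal_below c k (orth_poly c k)" if "k \<le> m" for k
      using less Suc that by simp
    have "moment_functional c (orth_poly c n * q) = 0" if "q = 0 \<or> degree q < n" for q
    proof -
      let ?r = "q - smult (coeff q m) (orth_poly c m)"
      have "?r = 0 \<or> degree ?r < m"
        using that Suc by (intro minus_smult_monic_eq_0_or_degree_less) auto
      then have "moment_functional c (orth_poly c n * ?r) = 0"
        using orth less.prems Suc
        by (intro orthogonal_belowD[OF orthogonal_below_orth_poly_Suc[of m, folded Suc]]) auto
      moreover have "moment_functional c (orth_poly c n * orth_poly c m) = 0"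
        using orth less.prems unfolding Suc by (intro moment_functional_orth_poly_Suc_orth_poly) auto
      ultimately show ?thesis
        by (simp add: right_diff_distrib moment_functional_diff moment_functional_smult)
    qed
    then show ?thesis by (simp add: orthogonal_below_def)
  qed
qed

lemma det_hankel_mat_eq_prod_orth_norm:
  assumes "\<And>k. Suc k < n \<Longrightarrow> orth_norm c k \<noteq> 0"
  shows "det (hankel_mat n c) = (\<Prod>k<n. orth_norm c k)"
  unfolding orth_norm_def
proof (rule det_hankel_mat_orthogonal[OF monic_sequence_orth_poly])
  fix j k assume "j < k" "k < n"
  then show "moment_functional c (orth_poly c k * orth_poly c j) = 0"
    using assms by (intro orthogonal_belowD[OF orthogonal_below_orth_poly]) auto
qed

lemma all_det_hankel_mat_nonzero_iff:
  "(\<forall>n\<ge>1. det (hankel_mat n c) \<noteq> 0) \<longleftrightarrow> (\<forall>n. orth_norm c n \<noteq> 0)"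
proof
  assume det: "\<forall>n\<ge>1. det (hankel_mat n c) \<noteq> 0"
  show "\<forall>n. orth_norm c n \<noteq> 0"
  proof
    fix n show "orth_norm c n \<noteq> 0"
    proof (induction n rule: less_induct)
      case (less n)
      then have "det (hankel_mat (Suc n) c) = (\<Prod>k<Suc n. orth_norm c k)"
        by (intro det_hankel_mat_eq_prod_orth_norm) simp
      moreover have "det (hankel_mat (Suc n) c) \<noteq> 0"
        using det by simp
      ultimately show ?case by simp
    qed
  qed
qed (simp add: det_hankel_mat_eq_prod_orth_norm)

lemma moment_functional_orth_poly:
  assumes "\<And>k. k < n \<Longrightarrow> orth_norm c k \<noteq> 0"
  shows "moment_functional c (orth_poly c n) = (if n = 0 then c 0 else 0)"
  using orthogonal_belowD[OF orthogonal_below_orth_poly, of n c 1] assms by auto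

subsection \<open>Characteristic two\<close>

definition square_defect :: "(nat \<Rightarrow> 'a::comm_ring_1) \<Rightarrow> 'a poly \<Rightarrow> 'a" where
  "square_defect c p = moment_functional c ([:0, 1, 1:] * p\<^sup>2) - moment_functional c p"

lemma square_defect_monom:
  "square_defect c (monom 1 n) = c (2 * n + 1) + c (2 * n + 2) - c n"
proof -
  have "[:0, 1, 1:] * (monom 1 n)\<^sup>2 = monom (1::'a) (2 * n + 1) + monom 1 (2 * n + 2)"
    by (simp add: monom_power monom_Suc mult.commute)
  then show ?thesis
    by (simp only: square_defect_def moment_functional_add moment_functional_monom mult_1_left)
qed

lemma square_defect_add:
  assumes "CHAR('a::comm_ring_1) = 2"
  shows "square_defect c (p + q) = square_defect c p + square_defect c (q :: 'a poly)"
proof -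
  have "(p + q)\<^sup>2 = p\<^sup>2 + q\<^sup>2"
    using assms by (intro freshmans_dream) simp_all
  then show ?thesis
    by (simp only: square_defect_def distrib_left moment_functional_add add_diff_add)
qed

declare add_bit_eq_xor [simp del] mult_bit_eq_and [simp del]

lemma CHAR_bit [simp]: "CHAR(bit) = 2"
  by (rule CHAR_eq_posI) (auto simp: less_2_cases_iff)

lemma all_square_defect_eq_0_iff:
  fixes c :: "nat \<Rightarrow> bit"
  assumes "monic_sequence b"
  shows "(\<forall>p. square_defect c p = 0) \<longleftrightarrow> (\<forall>k. square_defect c (b k) = 0)"
proof (intro iffI allI)
  fix p assume basis: "\<forall>k. square_defect c (b k) = 0"
  show "square_defect c p = 0"
    using assms
  proof (induction p rule: monic_sequence_induct)
    case (smult a k)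
    show ?case using basis by (cases a) (simp_all add: square_defect_def)
  qed (simp add: square_defect_add)
qed blast

lemma orth_norm_Suc_bit:
  fixes c :: "nat \<Rightarrow> bit"
  assumes norm: "\<And>k. k \<le> n \<Longrightarrow> orth_norm c k = 1"
  shows "orth_norm c (Suc n)
    = moment_functional c ([:0, 1, 1:] * (orth_poly c n)\<^sup>2) + of_bool (n > 0)"
proof -
  let ?L = "moment_functional c" and ?p = "orth_poly c"
  define a where "a = ?L (pCons 0 ((?p n)\<^sup>2))"
  define r where "r = (case n of 0 \<Rightarrow> 0 | Suc m \<Rightarrow> ?p m)"
  have "?p (Suc n) = pCons 0 (?p n) + smult a (?p n) + r"
    unfolding orth_poly_Suc a_def r_def
    by (cases n) (simp_all only: norm order_refl le_SucI minus_CHAR_2 semiring_char_poly CHAR_bit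
        nat.case div_by_1 smult_1_left add_0_right)
  then have "(?p (Suc n))\<^sup>2 = (pCons 0 (?p n))\<^sup>2 + smult (a\<^sup>2) ((?p n)\<^sup>2) + r\<^sup>2"
    by (simp only: freshmans_dream semiring_char_poly CHAR_bit two_is_prime_nat smult_power)
  moreover have "a\<^sup>2 = a"
    by (cases a) simp_all
  ultimately have "orth_norm c (Suc n) = ?L ((pCons 0 (?p n))\<^sup>2) + a * orth_norm c n + ?L (r\<^sup>2)"
    by (simp only: orth_norm_def moment_functional_add moment_functional_smult)
  also have "a * orth_norm c n = a"
    by (simp add: norm)
  also have "?L (r\<^sup>2) = of_bool (n > 0)"
    using norm by (simp add: r_def split: nat.split flip: orth_norm_def)
  also have "?L ((pCons 0 (?p n))\<^sup>2) + a = ?L ([:0, 1, 1:] * (?p n)\<^sup>2)"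
    unfolding a_def moment_functional_add [symmetric] by (simp add: power2_eq_square add.commute)
  finally show ?thesis .
qed

lemma orth_norm_Suc_eq_square_defect:
  fixes c :: "nat \<Rightarrow> bit"
  assumes "\<And>k. k \<le> n \<Longrightarrow> orth_norm c k \<noteq> 0"
  shows "orth_norm c (Suc n) = square_defect c (orth_poly c n) + 1"
proof -
  have norm: "orth_norm c k = 1" if "k \<le> n" for k
    using assms[OF that] by (simp only: bit_not_zero_iff)
  have "c 0 = 1"
    using norm[of 0] by (simp add: orth_norm_def)
  then have "moment_functional c (orth_poly c n) = of_bool (n = 0)"
    using assms by (subst moment_functional_orth_poly) auto
  then show ?thesis
    by (cases "n = 0") (simp_all add: orth_norm_Suc_bit norm square_defect_def add.assoc)
qed

lemma all_orth_norm_nonzero_iff_square_defect: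
  fixes c :: "nat \<Rightarrow> bit"
  assumes "c 0 = 1"
  shows "(\<forall>n. orth_norm c n \<noteq> 0) \<longleftrightarrow> (\<forall>n. square_defect c (orth_poly c n) = 0)"
proof
  assume "\<forall>n. orth_norm c n \<noteq> 0"
  then show "\<forall>n. square_defect c (orth_poly c n) = 0"
    using orth_norm_Suc_eq_square_defect[of _ c] by simp
next
  assume defect: "\<forall>n. square_defect c (orth_poly c n) = 0"
  show "\<forall>n. orth_norm c n \<noteq> 0"
  proof
    fix n show "orth_norm c n \<noteq> 0"
    proof (induction n rule: less_induct)
      case (less n)
      show ?case
      proof (cases n)
        case 0
        then show ?thesis using assms by (simp add: orth_norm_def)
      next
        case (Suc m)
        then show ?thesis using less orth_norm_Suc_eq_square_defect[of m c] defect by simp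
      qed
    qed
  qed
qed

theorem hankel_dets_nonzero_iff_recurrence:
  fixes c :: "nat \<Rightarrow> bit"
  assumes "c 0 = 1"
  shows "(\<forall>n\<ge>1. det (hankel_mat n c) \<noteq> 0) \<longleftrightarrow> (\<forall>n. c n = c (2 * n + 1) + c (2 * n + 2))"
proof -
  have "(\<forall>n\<ge>1. det (hankel_mat n c) \<noteq> 0) \<longleftrightarrow> (\<forall>n. square_defect c (orth_poly c n) = 0)"
    unfolding all_det_hankel_mat_nonzero_iff
    by (rule all_orth_norm_nonzero_iff_square_defect) fact
  also have "\<dots> \<longleftrightarrow> (\<forall>n. square_defect c (monom 1 n) = 0)"
    by (simp only: monic_sequence_orth_poly monic_sequence_monom flip: all_square_defect_eq_0_iff)
  also have "\<dots> \<longleftrightarrow> (\<forall>n. c n = c (2 * n + 1) + c (2 * n + 2))"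
    unfolding square_defect_monom right_minus_eq by (simp only: eq_commute)
  finally show ?thesis .
qed

theorem theorem1p5:
  fixes c :: "nat \<Rightarrow> int"
  assumes "zero_one_seq c"
    and "c 0 = 1"
  shows "apwenian c \<longleftrightarrow> (\<forall>n. [c n = c (2 * n + 1) + c (2 * n + 2)] (mod 2))"
proof -
  have cong_iff: "[k = l] (mod 2) \<longleftrightarrow> (of_int k :: bit) = of_int l" for k l
    by (simp add: of_int_eq_iff_cong_CHAR)
  have "apwenian c \<longleftrightarrow> (\<forall>n\<ge>1. (of_int (hankel_det n c) :: bit) \<noteq> 0)"
    using assms(1) by (simp add: apwenian_def cong_iff)
  also have "\<dots> \<longleftrightarrow> (\<forall>n. (of_int (c n) :: bit) = of_int (c (2 * n + 1)) + of_int (c (2 * n + 2)))"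
    unfolding of_int_hankel_det
    by (rule hankel_dets_nonzero_iff_recurrence) (simp add: assms(2))
  also have "\<dots> \<longleftrightarrow> (\<forall>n. [c n = c (2 * n + 1) + c (2 * n + 2)] (mod 2))"
    by (simp only: cong_iff of_int_add)
  finally show ?thesis .
qed

end
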